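(* Let $A\in\mathbb{R}^{m\times n}$, let $S=\begin{bmatrix} S_1 & S_2\\ S_2 & S_1\end{bmatrix}\in\mathbb{R}^{2m\times 2n}$ be the associated block-structure matrix, of rank $r$, with $\mathcal{R}(S_2)\subseteq\mathcal{R}(S_1)$, and let $S=LP^{-1}U$ be the decomposition described in the context, with $U=\begin{bmatrix}U_{11} & U_{12}\\ O & U_{22}\end{bmatrix}$. If $Q$ is a permutation matrix such that $$QL=\begin{bmatrix}L_r & \mathcal{O}\\ K & \mathcal{O}\end{bmatrix},$$ where $L_r\in\mathbb{R}^{r\times r}$ has rank $r$ and $K\in\mathbb{R}^{(2m-r)\times r}$, then $$S^{\{1,2\}}=U^{-1}PL^{\{1,2\}}$$ is a $\{1,2\}$-inverse of $S$, where $$L^{\{1,2\}}=\begin{bmatrix}L_r^{-1} & \mathcal{O}\\ \mathcal{O} & \mathcal{O}\end{bmatrix}Q\quad\text{and}\quad U^{-1}=\begin{bmatrix}U_{11}^{-1} & -U_{11}^{-1}U_{12}U_{22}^{-1}\\ O & U_{22}^{-1}\end{bmatrix}.$$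
   Context: For $A=(d_{ij})\in\mathbb{R}^{m\times n}$, $S_1,S_2\in\mathbb{R}^{m\times n}$ are the matrices with entries $(S_1)_{ij}=d_{ij}$ if $d_{ij}\ge 0$ and $0$ otherwise, and $(S_2)_{ij}=-d_{ij}$ if $d_{ij}<0$ and $0$ otherwise; so $A=S_1-S_2$, and the block-structure matrix associated with $A$ is $S=\begin{bmatrix} S_1 & S_2\\ S_2 & S_1\end{bmatrix}$. $\mathcal{R}(M)$ is the range (column space) of $M$, $M^{\dagger}$ the Moore–Penrose inverse, $O,\mathcal{O}$ zero blocks of appropriate size. A $\{1,2\}$-inverse of $S$ is a matrix $Y\in\mathbb{R}^{2n\times 2m}$ with $SYS=S$ and $YSY=Y$ (similarly for other matrices). CRRMCF (Column Rank Revealing Minimal Canonical Form): let $G$ be a real $p\times q$ matrix of rank $t$, and let $\{(r_k,c_k)\}_{k=1}^{t}$, $c_1<\dots<c_t$, be the positions of the topmost nonzero entries (pivots) of the columns of $G$. $G$ is in CRRMCF if all entries to the right of the pivot entries are zero. Explicitly: $G(r_k,c_k)\neq 0$; $G(i,j)=0$ for all $i$ if $j\notin\{c_1,\dots,c_t\}$; $G(i,c_k)=0$ if $i<r_k$; $G(r_k,j)=0$ if $j>c_k$. A CRRMCF decomposition of a $p\times q$ matrix $M$ is $M=\mathcal{L}U$ with $\mathcal{L}\in\mathbb{R}^{p\times q}$ in CRRMCF and $U\in\mathbb{R}^{q\times q}$ unit upper triangular. The decomposition $S=LP^{-1}U$: $S=\mathcal{L}U$ is a CRRMCF decomposition of $S$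 with $\mathcal{L}=\begin{bmatrix}\mathcal{L}_{11} & O\\ \mathcal{L}_{21} & \mathcal{L}_{22}\end{bmatrix}$ and $U=\begin{bmatrix}U_{11} & U_{12}\\ O & U_{22}\end{bmatrix}$, where $S_1=\mathcal{L}_{11}U_{11}$ and $S_1-S_2U_{11}^{-1}\mathcal{L}_{11}^{\dagger}S_2=\mathcal{L}_{22}U_{22}$ are CRRMCF decompositions, $\mathcal{L}_{21}=S_2U_{11}^{-1}$, $U_{12}=\mathcal{L}_{11}^{\dagger}S_2$; $P$ is a permutation matrix such that $L=\mathcal{L}P$ is lower triangular. *)

theory Defs
  imports
    "Jordan_Normal_Form.DL_Rank"
    "Jordan_Normal_Form.Gauss_Jordan_Elimination"
    "HOL-Combinatorics.Permutations"
begin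

abbreviation mrank :: "real mat \<Rightarrow> nat" where
  "mrank M \<equiv> vec_space.rank (dim_row M) M"

abbreviation mrange :: "real mat \<Rightarrow> real vec set" where
  "mrange M \<equiv> vec_space.col_space (dim_row M) M"

text \<open>Only meaningful for invertible square matrices, on which \<^const>\<open>mat_inverse\<close>
  does not return \<^const>\<open>None\<close>.\<close>

abbreviation inv_mat :: "real mat \<Rightarrow> real mat" where
  "inv_mat M \<equiv> the (mat_inverse M)"

definition permutation_matrix :: "nat \<Rightarrow> real mat \<Rightarrow> bool" where
  "permutation_matrix k P \<longleftrightarrow>
     (\<exists>\<pi>. \<pi> permutes {..<k} \<and> P = mat k k (\<lambda>(i, j). if i = \<pi> j then 1 else 0))"

text \<open>The library's \<^const>\<open>upper_triangular\<close> is meant for square matrices; the lower triangular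
  matrices needed here are rectangular.\<close>

definition lower_triangular_mat :: "real mat \<Rightarrow> bool" where
  "lower_triangular_mat M \<longleftrightarrow>
     (\<forall>i < dim_row M. \<forall>j < dim_col M. i < j \<longrightarrow> M $$ (i, j) = 0)"

definition unit_upper_triangular :: "real mat \<Rightarrow> bool" where
  "unit_upper_triangular M \<longleftrightarrow>
     square_mat M \<and> upper_triangular M \<and> (\<forall>i < dim_row M. M $$ (i, i) = 1)"

definition is_moore_penrose :: "real mat \<Rightarrow> real mat \<Rightarrow> bool" where
  "is_moore_penrose M X \<longleftrightarrow>
     X \<in> carrier_mat (dim_col M) (dim_row M) \<and>
     M * X * M = M \<and> X * M * X = X \<and>
     (M * X)\<^sup>T = M * X \<and> (X * M)\<^sup>T = X * M"

definition is_12_inverse :: "real mat \<Rightarrow> real mat \<Rightarrow> bool" where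
  "is_12_inverse M Y \<longleftrightarrow>
     Y \<in> carrier_mat (dim_col M) (dim_row M) \<and> M * Y * M = M \<and> Y * M * Y = Y"

definition S1_of :: "real mat \<Rightarrow> real mat" where
  "S1_of A = map_mat (\<lambda>d. if d \<ge> 0 then d else 0) A"

definition S2_of :: "real mat \<Rightarrow> real mat" where
  "S2_of A = map_mat (\<lambda>d. if d < 0 then - d else 0) A"

definition S_of :: "real mat \<Rightarrow> real mat" where
  "S_of A = four_block_mat (S1_of A) (S2_of A) (S2_of A) (S1_of A)"

text \<open>Column rank revealing minimal canonical form; \<open>(\<rho> k, \<gamma> k)\<close>, \<open>k < rank G\<close>, are the
  (0-based) pivot positions.\<close>

definition CRRMCF :: "real mat \<Rightarrow> bool" where
  "CRRMCF G \<longleftrightarrow>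
     (\<exists>\<rho> \<gamma> :: nat \<Rightarrow> nat.
        strict_mono_on {..<mrank G} \<gamma> \<and>
        (\<forall>k < mrank G. \<rho> k < dim_row G \<and> \<gamma> k < dim_col G \<and> G $$ (\<rho> k, \<gamma> k) \<noteq> 0) \<and>
        (\<forall>j < dim_col G. j \<notin> \<gamma> ` {..<mrank G} \<longrightarrow> (\<forall>i < dim_row G. G $$ (i, j) = 0)) \<and>
        (\<forall>k < mrank G. \<forall>i < \<rho> k. G $$ (i, \<gamma> k) = 0) \<and>
        (\<forall>k < mrank G. \<forall>j < dim_col G. \<gamma> k < j \<longrightarrow> G $$ (\<rho> k, j) = 0))"

definition CRRMCF_decomposition :: "real mat \<Rightarrow> real mat \<Rightarrow> real mat \<Rightarrow> bool" where
  "CRRMCF_decomposition M G U \<longleftrightarrow>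
     G \<in> carrier_mat (dim_row M) (dim_col M) \<and> CRRMCF G \<and>
     U \<in> carrier_mat (dim_col M) (dim_col M) \<and> unit_upper_triangular U \<and>
     M = G * U"

text \<open>The block decomposition of \<open>S_of A\<close> as \<open>L * inv_mat P * U\<close> with
  \<open>U = four_block_mat U11 U12 (0\<^sub>m n n) U22\<close>. That product formula is not a separate clause,
  since it follows from \<open>S_of A = G * U\<close> and \<open>L = G * P\<close>; see the lemma after the definition.\<close>

definition LPU_decomposition ::
  "real mat \<Rightarrow> real mat \<Rightarrow> real mat \<Rightarrow> real mat \<Rightarrow> real mat \<Rightarrow> real mat \<Rightarrow> bool" where
  "LPU_decomposition A L P U11 U12 U22 \<longleftrightarrow>
     (\<exists>L11 L11dag L21 L22 G U.
        CRRMCF_decomposition (S1_of A) L11 U11 \<and>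
        is_moore_penrose L11 L11dag \<and>
        CRRMCF_decomposition
          (S1_of A - S2_of A * inv_mat U11 * L11dag * S2_of A) L22 U22 \<and>
        L21 = S2_of A * inv_mat U11 \<and>
        U12 = L11dag * S2_of A \<and>
        G = four_block_mat L11 (0\<^sub>m (dim_row A) (dim_col A)) L21 L22 \<and>
        U = four_block_mat U11 U12 (0\<^sub>m (dim_col A) (dim_col A)) U22 \<and>
        CRRMCF_decomposition (S_of A) G U \<and>
        permutation_matrix (2 * dim_col A) P \<and>
        L = G * P \<and> lower_triangular_mat L)"

lemma permutation_matrix_inverse:
  assumes "permutation_matrix k P"
  shows "P \<in> carrier_mat k k" "inv_mat P \<in> carrier_mat k k"
    "P * inv_mat P = 1\<^sub>m k" "inv_mat P * P = 1\<^sub>m k"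
proof -
  obtain \<pi> where \<pi>: "\<pi> permutes {..<k}"
    and P: "P = mat k k (\<lambda>(i, j). if i = \<pi> j then 1 else 0)"
    using assms unfolding permutation_matrix_def by blast
  show PC: "P \<in> carrier_mat k k" unfolding P by simp
  have inj: "\<pi> i = \<pi> j \<longleftrightarrow> i = j" for i j
    using permutes_inj[OF \<pi>] by (auto dest: injD)
  have lt: "\<pi> i < k" if "i < k" for i
    using permutes_in_image[OF \<pi>, of i] that by simp
  have "P\<^sup>T * P = 1\<^sub>m k"
  proof (rule eq_matI)
    fix i j assume ij: "i < dim_row (1\<^sub>m k :: real mat)" "j < dim_col (1\<^sub>m k :: real mat)"
    hence "(P\<^sup>T * P) $$ (i, j)
        = (\<Sum>l = 0..<k. (if l = \<pi> i then 1 else 0) * (if l = \<pi> j then 1 else 0))"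
      unfolding P by (simp add: scalar_prod_def)
    also have "\<dots> = (\<Sum>l = 0..<k. if l = \<pi> i then (if i = j then 1 else 0) else 0)"
      by (rule sum.cong) (auto simp: inj)
    also have "\<dots> = (1\<^sub>m k) $$ (i, j)"
      using ij lt by simp
    finally show "(P\<^sup>T * P) $$ (i, j) = (1\<^sub>m k) $$ (i, j)" .
  qed (simp_all add: P)
  hence un: "P \<in> Units (ring_mat TYPE(real) k ())"
    using PC mat_mult_left_right_inverse[of "P\<^sup>T" k P]
    unfolding Units_def ring_mat_def by auto
  obtain B where B: "mat_inverse P = Some B"
    using mat_inverse(1)[OF PC, of "()"] un by (cases "mat_inverse P") auto
  show "inv_mat P \<in> carrier_mat k k" "P * inv_mat P = 1\<^sub>m k" "inv_mat P * P = 1\<^sub>m k"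
    using mat_inverse(2)[OF PC B] B by auto
qed

lemma LPU_decomposition_product:
  assumes dec: "LPU_decomposition A L P U11 U12 U22"
  shows "S_of A = L * inv_mat P * four_block_mat U11 U12 (0\<^sub>m (dim_col A) (dim_col A)) U22"
proof -
  define U where "U = four_block_mat U11 U12 (0\<^sub>m (dim_col A) (dim_col A)) U22"
  obtain G where c: "CRRMCF_decomposition (S_of A) G U"
    and p: "permutation_matrix (2 * dim_col A) P" and L: "L = G * P"
    using dec unfolding LPU_decomposition_def U_def by blast
  have d: "dim_col (S_of A) = 2 * dim_col A"
    by (simp add: S_of_def S1_of_def four_block_mat_def Let_def)
  have G: "G \<in> carrier_mat (dim_row (S_of A)) (2 * dim_col A)" and S: "S_of A = G * U"
    using c d unfolding CRRMCF_decomposition_def by auto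
  note q = permutation_matrix_inverse[OF p]
  have "L * inv_mat P = G * (P * inv_mat P)"
    unfolding L using G q by (intro assoc_mult_mat) auto
  also have "\<dots> = G" using G q by simp
  finally show ?thesis using S unfolding U_def by simp
qed

end

theory Submission
  imports Defs
begin

text \<open>
  Being a \<open>{1,2}\<close>-inverse survives a change of bases: if \<open>Y\<close> is one of \<open>M\<close>, and \<open>F\<close>, \<open>E\<close> are
  invertible, then \<open>E\<inverse> Y F\<inverse>\<close> is one of \<open>FME\<close>, because the inner factors cancel in the two
  defining products (\<open>is_12_inverse_equivalence\<close>). Both \<open>L\<close> and \<open>S\<close> are equivalent in
  this sense to the block matrix \<open>QL\<close>, whose columns beyond the \<open>r\<close>-th vanish and whose top left
  block \<open>L\<^sub>r\<close> is invertible since it has full rank; padding \<open>L\<^sub>r\<inverse>\<close> with zeros yields a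
  \<open>{1,2}\<close>-inverse of it (\<open>is_12_inverse_full_column_block\<close>). From \<open>L = Q\<inverse>(QL)\<close> one reads off the
  \<open>{1,2}\<close>-inverse of \<open>L\<close>, and from \<open>S = L(P\<inverse>U)\<close> with \<open>(P\<inverse>U)\<inverse> = U\<inverse>P\<close> that of \<open>S\<close>.

  The inverses of \<open>U11\<close>, \<open>U22\<close> and \<open>U\<close> exist because unit upper triangular matrices have
  determinant 1, and the block formula for \<open>U\<inverse>\<close> is checked by multiplying out
  (\<open>inv_mat_block_upper_triangular\<close>).
\<close>

lemma nonzero_det_inverse:
  assumes M: "M \<in> carrier_mat k k" and det: "det M \<noteq> 0"
  shows "invertible_mat M" and "inv_mat M \<in> carrier_mat k k"
    and "M * inv_mat M = 1\<^sub>m k" and "inv_mat M * M = 1\<^sub>m k"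
proof -
  have "mat_inverse M \<noteq> None"
    using mat_inverse(1)[OF M, of "()"] det_non_zero_imp_unit[OF M det, of "()"] by blast
  then obtain B where B: "mat_inverse M = Some B" by blast
  show inv: "inv_mat M \<in> carrier_mat k k" "M * inv_mat M = 1\<^sub>m k" "inv_mat M * M = 1\<^sub>m k"
    using mat_inverse(2)[OF M B] B by auto
  show "invertible_mat M"
    using M inv unfolding invertible_mat_def inverts_mat_def by (metis carrier_matD square_mat.simps)
qed

lemma inv_mat_eqI:
  assumes M: "M \<in> carrier_mat k k" and N: "N \<in> carrier_mat k k" and MN: "M * N = 1\<^sub>m k"
  shows "inv_mat M = N"
proof -
  have "det M * det N = 1"
    using det_mult[OF M N] MN by simp
  hence "det M \<noteq> 0" by auto
  note inv = nonzero_det_inverse[OF M this]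
  have "inv_mat M = inv_mat M * (M * N)"
    using inv(2) MN by simp
  also have "\<dots> = (inv_mat M * M) * N"
    using inv(2) M N by (intro assoc_mult_mat[symmetric])
  also have "\<dots> = N"
    using inv(4) N by simp
  finally show ?thesis .
qed

lemma unit_upper_triangular_det:
  assumes M: "M \<in> carrier_mat k k" and tri: "unit_upper_triangular M"
  shows "det M = 1"
proof -
  have "det M = prod_list (diag_mat M)"
    using tri M by (intro det_upper_triangular) (auto simp: unit_upper_triangular_def)
  also have "diag_mat M = replicate k 1"
    using tri M by (intro nth_equalityI) (auto simp: diag_mat_def unit_upper_triangular_def)
  finally show ?thesis by simp
qed

text \<open>The only block of the product with the claimed inverse that is not immediate is the upper
  right one, where the \<open>A\<close> in front of \<open>A\<inverse>BD\<inverse>\<close> cancels, so that it is \<open>-BD\<inverse> + BD\<inverse> = 0\<close>.\<close>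

lemma inv_mat_block_upper_triangular:
  assumes A: "A \<in> carrier_mat p p" "det A \<noteq> 0"
    and D: "D \<in> carrier_mat q q" "det D \<noteq> 0"
    and B: "B \<in> carrier_mat p q"
  shows "inv_mat (four_block_mat A B (0\<^sub>m q p) D) =
    four_block_mat (inv_mat A) (- (inv_mat A * B * inv_mat D)) (0\<^sub>m q p) (inv_mat D)"
proof -
  note a = nonzero_det_inverse[OF A] and d = nonzero_det_inverse[OF D]
  let ?X = "inv_mat A * B * inv_mat D"
  have X: "?X \<in> carrier_mat p q" using a d B by auto
  have "A * ?X = (A * inv_mat A) * B * inv_mat D"
    using A(1) a(2) B d(2) by (simp add: assoc_mult_mat[of _ p p _ q _ q] assoc_mult_mat[of _ p p _ p _ q])
  also have "\<dots> = B * inv_mat D"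
    using a(3) B by simp
  finally have AX: "A * ?X = B * inv_mat D" .
  have Z: "B * inv_mat D \<in> carrier_mat p q" using B d(2) by auto
  have "A * (- ?X) + B * inv_mat D = - (A * ?X) + B * inv_mat D"
    by (subst uminus_mult_right_mat) (use carrier_matD[OF A(1)] carrier_matD[OF X] in presburger)+
  also have "\<dots> = 0\<^sub>m p q"
    unfolding AX by (rule uminus_l_inv_mat[OF Z])
  finally have upper_right: "A * (- ?X) + B * inv_mat D = 0\<^sub>m p q" .
  have nX: "- ?X \<in> carrier_mat p q" using X by auto
  have "four_block_mat A B (0\<^sub>m q p) D * four_block_mat (inv_mat A) (- ?X) (0\<^sub>m q p) (inv_mat D)
      = four_block_mat (A * inv_mat A + B * 0\<^sub>m q p) (A * (- ?X) + B * inv_mat D)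
          (0\<^sub>m q p * inv_mat A + D * 0\<^sub>m q p) (0\<^sub>m q p * (- ?X) + D * inv_mat D)"
    by (rule mult_four_block_mat[OF A(1) B zero_carrier_mat D(1) a(2) nX zero_carrier_mat d(2)])
  also have "\<dots> = four_block_mat (1\<^sub>m p) (0\<^sub>m p q) (0\<^sub>m q p) (1\<^sub>m q)"
    unfolding upper_right a(3) d(3) left_mult_zero_mat[OF nX]
    using D(1) B a(2) by simp
  also have "\<dots> = 1\<^sub>m (p + q)" by simp
  finally have "four_block_mat A B (0\<^sub>m q p) D * four_block_mat (inv_mat A) (- ?X) (0\<^sub>m q p) (inv_mat D)
      = 1\<^sub>m (p + q)" .
  then show ?thesis
    by (rule inv_mat_eqI[OF four_block_carrier_mat[OF A(1) D(1)] four_block_carrier_mat[OF a(2) d(2)]])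
qed

text \<open>Both defining equations collapse once \<open>F'F\<close> and \<open>EE'\<close> are cancelled:
  \<open>(FME)(E'YF') = F(MY)F'\<close>, and multiplying this by \<open>FME\<close> on the right, or by \<open>E'YF'\<close> on the left,
  leaves \<open>F(MYM)E\<close> and \<open>E'(YMY)F'\<close>.\<close>

lemma is_12_inverse_equivalence:
  assumes M: "M \<in> carrier_mat p q" and Y: "is_12_inverse M Y"
    and F: "F \<in> carrier_mat p p" and F': "F' \<in> carrier_mat p p" and F'F: "F' * F = 1\<^sub>m p"
    and E: "E \<in> carrier_mat q q" and E': "E' \<in> carrier_mat q q" and EE': "E * E' = 1\<^sub>m q"
  shows "is_12_inverse (F * M * E) (E' * Y * F')"
proof -
  have YC: "Y \<in> carrier_mat q p" and MYM: "M * Y * M = M" and YMY: "Y * M * Y = Y"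
    using Y M by (auto simp: is_12_inverse_def)
  note C = M YC F F' E E'
  have MYM': "M * (Y * M) = M" and YMY': "Y * (M * Y) = Y"
    using MYM YMY assoc_mult_mat[OF M YC M] assoc_mult_mat[OF YC M YC] by auto
  have cancel_E: "E * (E' * X) = X" if "X \<in> carrier_mat q l" for X l
    using assoc_mult_mat[OF E E' that] EE' that by simp
  have cancel_F: "F' * (F * X) = X" if "X \<in> carrier_mat p l" for X l
    using assoc_mult_mat[OF F' F that] F'F that by simp
  have 1: "(F * M * E) * (E' * Y * F') = F * (M * Y) * F'"
  proof -
    have "(F * M * E) * (E' * Y * F') = (F * M) * (E * (E' * (Y * F')))"
      using C by (simp add: assoc_mult_mat[of _ p q _ q _ p] assoc_mult_mat[of _ p p _ q _ p]
          assoc_mult_mat[of _ q q _ p _ p])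
    also have "\<dots> = F * (M * Y) * F'"
      using C by (simp add: cancel_E[of _ p] assoc_mult_mat[of _ p p _ q _ p]
         assoc_mult_mat[of _ p p _ p _ p] assoc_mult_mat[of _ p q _ p _ p])
    finally show ?thesis .
  qed
  have "F * (M * Y) * F' * (F * M * E) = F * (M * Y) * (F' * (F * (M * E)))"
    using C by (simp add: assoc_mult_mat[of _ p p _ p _ q] assoc_mult_mat[of _ p p _ q _ q])
  also have "\<dots> = F * (M * (Y * M)) * E"
    using C by (simp add: cancel_F[of _ q] assoc_mult_mat[of _ p p _ p _ q]
        assoc_mult_mat[of _ p p _ q _ q] assoc_mult_mat[of _ p q _ p _ q] assoc_mult_mat[of _ p q _ q _ q]
        assoc_mult_mat[of _ q p _ q _ q])
  finally have 2: "F * (M * Y) * F' * (F * M * E) = F * M * E"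
    unfolding MYM' .
  have "E' * Y * F' * (F * (M * Y) * F') = E' * Y * (F' * (F * ((M * Y) * F')))"
    using C by (simp add: assoc_mult_mat[of _ p p _ p _ p] assoc_mult_mat[of _ q p _ p _ p]
        assoc_mult_mat[of _ q q _ p _ p])
  also have "\<dots> = E' * (Y * (M * Y)) * F'"
    using C by (simp add: cancel_F[of _ p] assoc_mult_mat[of _ q q _ p _ p]
        assoc_mult_mat[of _ q p _ p _ p] assoc_mult_mat[of _ q p _ q _ p] assoc_mult_mat[of _ p q _ p _ p])
  finally have 3: "E' * Y * F' * (F * (M * Y) * F') = E' * Y * F'"
    unfolding YMY' .
  have "E' * Y * F' * (F * M * E) * (E' * Y * F') = E' * Y * F' * ((F * M * E) * (E' * Y * F'))"
    using C by (intro assoc_mult_mat[of _ q p _ q _ p]) auto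
  then show ?thesis
    using C 1 2 3 by (auto simp: is_12_inverse_def)
qed

text \<open>The product of the two matrices, taken with the candidate inverse on the left, is the
  diagonal projection onto the first \<open>r\<close> coordinates. It fixes the given matrix from the right
  because the last \<open>t\<close> columns of that matrix are zero, and fixes the candidate from the left
  because the last \<open>t\<close> rows of the candidate are zero.\<close>

lemma is_12_inverse_full_column_block:
  assumes C: "C \<in> carrier_mat r r" "det C \<noteq> 0" and K: "K \<in> carrier_mat s r"
  shows "is_12_inverse (four_block_mat C (0\<^sub>m r t) K (0\<^sub>m s t))
    (four_block_mat (inv_mat C) (0\<^sub>m r s) (0\<^sub>m t r) (0\<^sub>m t s))"
    (is "is_12_inverse ?B ?Y")
proof -
  note c = nonzero_det_inverse[OF C]
  have YB: "?Y * ?B = four_block_mat (1\<^sub>m r) (0\<^sub>m r t) (0\<^sub>m t r) (0\<^sub>m t t)"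
    using C(1) K c(2,4) by (subst mult_four_block_mat[of _ r r _ s _ t _ _ r _ t]) auto
  have BC: "?B \<in> carrier_mat (r + s) (r + t)" and YC: "?Y \<in> carrier_mat (r + t) (r + s)"
    using C(1) K c(2) by auto
  have "?B * ?Y * ?B = ?B * (?Y * ?B)"
    by (rule assoc_mult_mat[OF BC YC BC])
  also have "\<dots> = ?B"
    unfolding YB using C(1) K by (subst mult_four_block_mat[of _ r r _ t _ s _ _ r _ t]) auto
  finally have "?B * ?Y * ?B = ?B" .
  moreover have "?Y * ?B * ?Y = ?Y"
    unfolding YB using c(2) by (subst mult_four_block_mat[of _ r r _ t _ t _ _ r _ s]) auto
  ultimately show ?thesis
    unfolding is_12_inverse_def using carrier_matD[OF BC] YC by metis
qed

theorem theorem3p4: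
  fixes A L P U11 U12 U22 U Q L\<^sub>r K L12 :: "real mat" and m n r :: nat
  assumes "A \<in> carrier_mat m n"
    and "r = mrank (S_of A)"
    and "mrange (S2_of A) \<subseteq> mrange (S1_of A)"
    and "LPU_decomposition A L P U11 U12 U22"
    and "U = four_block_mat U11 U12 (0\<^sub>m n n) U22"
    and "permutation_matrix (2 * m) Q"
    and "L\<^sub>r \<in> carrier_mat r r" and "mrank L\<^sub>r = r"
    and "K \<in> carrier_mat (2 * m - r) r"
    and "Q * L = four_block_mat L\<^sub>r (0\<^sub>m r (2 * n - r)) K (0\<^sub>m (2 * m - r) (2 * n - r))"
    and "L12 = four_block_mat (inv_mat L\<^sub>r) (0\<^sub>m r (2 * m - r))
                    (0\<^sub>m (2 * n - r) r) (0\<^sub>m (2 * n - r) (2 * m - r)) * Q"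
  shows "invertible_mat L\<^sub>r \<and> invertible_mat U11 \<and> invertible_mat U22 \<and> invertible_mat U \<and>
         inv_mat U = four_block_mat (inv_mat U11) (- (inv_mat U11 * U12 * inv_mat U22))
                                    (0\<^sub>m n n) (inv_mat U22) \<and>
         is_12_inverse L L12 \<and>
         is_12_inverse (S_of A) (inv_mat U * P * L12)"
proof -
  have Adim: "dim_row A = m" "dim_col A = n" using assms(1) by auto
  have S2: "S2_of A \<in> carrier_mat m n" and S1: "S1_of A \<in> carrier_mat m n"
    using assms(1) by (auto simp: S2_of_def S1_of_def)
  have S: "S_of A \<in> carrier_mat (2 * m) (2 * n)"
    using S1 S2 unfolding S_of_def by (metis four_block_carrier_mat mult_2)
  obtain L11 L11dag L22 G where
      dec11: "CRRMCF_decomposition (S1_of A) L11 U11"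
    and mp: "is_moore_penrose L11 L11dag"
    and dec22: "CRRMCF_decomposition
          (S1_of A - S2_of A * inv_mat U11 * L11dag * S2_of A) L22 U22"
    and U12: "U12 = L11dag * S2_of A"
    and dec: "CRRMCF_decomposition (S_of A) G U"
    and P: "permutation_matrix (2 * n) P"
    and L: "L = G * P"
    using assms(4,5) unfolding LPU_decomposition_def Adim by blast
  have U11: "U11 \<in> carrier_mat n n" "det U11 = 1" and L11: "L11 \<in> carrier_mat m n"
    using dec11 S1 unit_upper_triangular_det by (auto simp: CRRMCF_decomposition_def)
  have U22: "U22 \<in> carrier_mat n n" "det U22 = 1"
    using dec22 S2 unit_upper_triangular_det by (auto simp: CRRMCF_decomposition_def)
  have U12C: "U12 \<in> carrier_mat n n"
    using mp L11 S2 unfolding U12 is_moore_penrose_def by auto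
  have U: "U \<in> carrier_mat (2 * n) (2 * n)" "det U = 1" and G: "G \<in> carrier_mat (2 * m) (2 * n)"
    using dec S unit_upper_triangular_det by (auto simp: CRRMCF_decomposition_def)
  have "det L\<^sub>r \<noteq> 0"
    using assms(7,8) vec_space.det_rank_iff[OF assms(7)] by simp
  note Lr = assms(7) this
  note P = permutation_matrix_inverse[OF P] and Q = permutation_matrix_inverse[OF assms(6)]
  have LC: "L \<in> carrier_mat (2 * m) (2 * n)" using G P L by auto
  \<comment> \<open>Comparing dimensions in the block form of \<open>Q * L\<close> shows that \<open>r \<le> 2 * m\<close> and \<open>r \<le> 2 * n\<close>,
    so the truncated differences are honest ones.\<close>
  have dims: "r + (2 * m - r) = 2 * m" "r + (2 * n - r) = 2 * n"
    using arg_cong[OF assms(10), of dim_row] arg_cong[OF assms(10), of dim_col] LC Q(1) assms(7)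
    by auto
  let ?Y = "four_block_mat (inv_mat L\<^sub>r) (0\<^sub>m r (2 * m - r))
                    (0\<^sub>m (2 * n - r) r) (0\<^sub>m (2 * n - r) (2 * m - r))"
  have QL: "Q * L \<in> carrier_mat (2 * m) (2 * n)" using Q LC by auto
  have YC: "?Y \<in> carrier_mat (2 * n) (2 * m)"
    using nonzero_det_inverse(2)[OF Lr] dims by (metis four_block_carrier_mat zero_carrier_mat)
  have Y: "is_12_inverse (Q * L) ?Y"
    unfolding assms(10) using Lr assms(9) by (rule is_12_inverse_full_column_block)
  have "is_12_inverse (inv_mat Q * (Q * L) * 1\<^sub>m (2 * n)) (1\<^sub>m (2 * n) * ?Y * Q)"
    using QL Y Q by (intro is_12_inverse_equivalence[of _ "2 * m" "2 * n"]) auto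
  also have "inv_mat Q * (Q * L) * 1\<^sub>m (2 * n) = L"
    using assoc_mult_mat[OF Q(2,1) LC] Q(4) LC by simp
  also have "1\<^sub>m (2 * n) * ?Y * Q = L12"
    unfolding left_mult_one_mat[OF YC] assms(11) ..
  finally have L12: "is_12_inverse L L12" .
  have L12C: "L12 \<in> carrier_mat (2 * n) (2 * m)"
    using L12 LC by (simp add: is_12_inverse_def)
  note Ui = nonzero_det_inverse[OF U(1), unfolded U(2), simplified]
  have "inv_mat P * U * (inv_mat U * P) = inv_mat P * ((U * inv_mat U) * P)"
    using P U(1) Ui(2) by (simp add: assoc_mult_mat[of _ "2*n" "2*n" _ "2*n" _ "2*n"])
  also have "\<dots> = 1\<^sub>m (2 * n)" using Ui P by simp
  finally have E: "inv_mat P * U * (inv_mat U * P) = 1\<^sub>m (2 * n)" .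
  have "is_12_inverse (1\<^sub>m (2 * m) * L * (inv_mat P * U)) (inv_mat U * P * L12 * 1\<^sub>m (2 * m))"
    using E LC L12 U Ui P by (intro is_12_inverse_equivalence[of _ "2 * m" "2 * n"]) auto
  also have "1\<^sub>m (2 * m) * L * (inv_mat P * U) = L * inv_mat P * U"
    using LC P U(1) by (simp add: assoc_mult_mat[of _ "2*m" "2*n" _ "2*n" _ "2*n"])
  also have "\<dots> = S_of A"
    using LPU_decomposition_product[OF assms(4)] Adim assms(5) by simp
  also have "inv_mat U * P * L12 * 1\<^sub>m (2 * m) = inv_mat U * P * L12"
    using L12C Ui P by simp
  finally have "is_12_inverse (S_of A) (inv_mat U * P * L12)" .
  moreover have "inv_mat U = four_block_mat (inv_mat U11) (- (inv_mat U11 * U12 * inv_mat U22))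
                                    (0\<^sub>m n n) (inv_mat U22)"
    unfolding assms(5) using U11 U22 U12C by (intro inv_mat_block_upper_triangular) auto
  ultimately show ?thesis
    using L12 Ui(1) nonzero_det_inverse(1)[OF Lr] nonzero_det_inverse(1)[OF U11(1)]
      nonzero_det_inverse(1)[OF U22(1)] U11(2) U22(2) by simp
qed

end
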